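(* Let $n\ge 1$. The six pairs of set-valued statistics $$(\mathrm{Asc},\mathrm{Lap}),\ (\mathrm{Plat},\mathrm{Lap}),\ (\mathrm{Des},\mathrm{Rpd}),\ (\mathrm{Asc},\mathrm{Eud}),\ (\mathrm{Plat},\mathrm{Rpd}),\ (\mathrm{Des},\mathrm{Eud})$$ are all equidistributed on $\mathcal{Q}_n$. Consequently the following six identities hold: $$\sum_{\sigma\in\mathcal{Q}_n}x^{\mathrm{asc}(\sigma)}y^{\mathrm{lap}(\sigma)}=\sum_{\sigma\in\mathcal{Q}_n}x^{\mathrm{plat}(\sigma)}y^{\mathrm{lap}(\sigma)}=\sum_{\sigma\in\mathcal{Q}_n}x^{\mathrm{des}(\sigma)}y^{\mathrm{rpd}(\sigma)},$$ $$\sum_{\sigma\in\mathcal{Q}_n}x^{\mathrm{asc}(\sigma)}y^{\mathrm{lap}(\sigma)}=\sum_{\sigma\in\mathcal{Q}_n}x^{\mathrm{plat}(\sigma)}y^{\mathrm{rpd}(\sigma)}=\sum_{\sigma\in\mathcal{Q}_n}x^{\mathrm{des}(\sigma)}y^{\mathrm{rpd}(\sigma)},$$ $$\sum_{\sigma\in\mathcal{Q}_n}x^{\mathrm{asc}(\sigma)}y^{\mathrm{eud}(\sigma)}=\sum_{\sigma\in\mathcal{Q}_n}x^{\mathrm{plat}(\sigma)}y^{\mathrm{rpd}(\sigma)}=\sum_{\sigma\in\mathcal{Q}_n}x^{\mathrm{des}(\sigma)}y^{\mathrm{eud}(\sigma)},$$ $$\sum_{\sigma\in\mathcal{Q}_n}x^{\mathrm{asc}(\sigma)}y^{\mathrm{eud}(\sigma)}=\sum_{\sigma\in\mathcal{Q}_n}x^{\mathrm{plat}(\sigma)}y^{\mathrm{lap}(\sigma)}=\sum_{\sigma\in\mathcal{Q}_n}x^{\mathrm{des}(\sigma)}y^{\mathrm{eud}(\sigma)},$$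 $$\sum_{\sigma\in\mathcal{Q}_n}x^{\mathrm{asc}(\sigma)}y^{\mathrm{lap}(\sigma)}=\sum_{\sigma\in\mathcal{Q}_n}x^{\mathrm{plat}(\sigma)}y^{\mathrm{rpd}(\sigma)}=\sum_{\sigma\in\mathcal{Q}_n}x^{\mathrm{des}(\sigma)}y^{\mathrm{eud}(\sigma)},$$ $$\sum_{\sigma\in\mathcal{Q}_n}x^{\mathrm{asc}(\sigma)}y^{\mathrm{eud}(\sigma)}=\sum_{\sigma\in\mathcal{Q}_n}x^{\mathrm{plat}(\sigma)}y^{\mathrm{lap}(\sigma)}=\sum_{\sigma\in\mathcal{Q}_n}x^{\mathrm{des}(\sigma)}y^{\mathrm{rpd}(\sigma)}.$$
   Context: $\mathcal{Q}_n$ is the set of Stirling permutations of order $n$: words $\sigma=\sigma_1\cdots\sigma_{2n}$ that are arrangements of the multiset $\{1,1,2,2,\ldots,n,n\}$ such that whenever $i<s<j$ and $\sigma_i=\sigma_j$ one has $\sigma_s\ge\sigma_i$. Set $\sigma_0=\sigma_{2n+1}=0$. All sets below are subsets of $[n]=\{1,\ldots,n\}$ (sets of values), with indices $i,j$ ranging over $\{1,\ldots,2n\}$: - $\mathrm{Asc}(\sigma)=\{\sigma_i\mid\sigma_{i-1}<\sigma_i\}$ - $\mathrm{Plat}(\sigma)=\{\sigma_i\mid\sigma_i=\sigma_{i+1}\}$ - $\mathrm{Des}(\sigma)=\{\sigma_i\mid\sigma_i>\sigma_{i+1}\}$ - $\mathrm{Lap}(\sigma)=\{\sigma_i\mid\sigma_{i-1}<\sigma_i=\sigma_{i+1}\}$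 - $\mathrm{Rpd}(\sigma)=\{\sigma_i\mid\sigma_{i-1}=\sigma_i>\sigma_{i+1}\}$ - $\mathrm{Eud}(\sigma)=\{\sigma_i\mid\sigma_{i-1}<\sigma_i=\sigma_j>\sigma_{j+1}\text{ for some } j>i\}$ The lower-case statistics $\mathrm{asc},\mathrm{plat},\mathrm{des},\mathrm{lap},\mathrm{rpd},\mathrm{eud}$ denote the cardinalities of the corresponding sets. Two pairs $(S,T)$ and $(S',T')$ of set-valued statistics are equidistributed on $\mathcal{Q}_n$ if for all $A,B\subseteq[n]$ the number of $\sigma\in\mathcal{Q}_n$ with $S(\sigma)=A$, $T(\sigma)=B$ equals the number of $\sigma\in\mathcal{Q}_n$ with $S'(\sigma)=A$, $T'(\sigma)=B$. *)

theory Defs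
  imports "HOL-Combinatorics.Multiset_Permutations"
begin

text \<open>
  Words are lists of natural numbers. Letters are accessed with 1-based positions, and the
  word is bordered by zeros: \<open>letter \<sigma> 0 = letter \<sigma> (length \<sigma> + 1) = 0\<close>.
\<close>

definition letter :: "nat list \<Rightarrow> nat \<Rightarrow> nat" where
  "letter \<sigma> i = (0 # \<sigma> @ [0]) ! i"

definition stirling_perms :: "nat \<Rightarrow> nat list set" where
  "stirling_perms n =
     {\<sigma> \<in> permutations_of_multiset (repeat_mset 2 (mset_set {1..n})).
        \<forall>i s j. 1 \<le> i \<and> i < s \<and> s < j \<and> j \<le> 2 * n \<and> letter \<sigma> i = letter \<sigma> j
          \<longrightarrow> letter \<sigma> s \<ge> letter \<sigma> i}"

definition Asc :: "nat list \<Rightarrow> nat set" where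
  "Asc \<sigma> = {letter \<sigma> i | i. i \<in> {1..length \<sigma>} \<and> letter \<sigma> (i - 1) < letter \<sigma> i}"

definition Plat :: "nat list \<Rightarrow> nat set" where
  "Plat \<sigma> = {letter \<sigma> i | i. i \<in> {1..length \<sigma>} \<and> letter \<sigma> i = letter \<sigma> (i + 1)}"

definition Des :: "nat list \<Rightarrow> nat set" where
  "Des \<sigma> = {letter \<sigma> i | i. i \<in> {1..length \<sigma>} \<and> letter \<sigma> i > letter \<sigma> (i + 1)}"

definition Lap :: "nat list \<Rightarrow> nat set" where
  "Lap \<sigma> = {letter \<sigma> i | i. i \<in> {1..length \<sigma>} \<and>
     letter \<sigma> (i - 1) < letter \<sigma> i \<and> letter \<sigma> i = letter \<sigma> (i + 1)}"

definition Rpd :: "nat list \<Rightarrow> nat set" where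
  "Rpd \<sigma> = {letter \<sigma> i | i. i \<in> {1..length \<sigma>} \<and>
     letter \<sigma> (i - 1) = letter \<sigma> i \<and> letter \<sigma> i > letter \<sigma> (i + 1)}"

definition Eud :: "nat list \<Rightarrow> nat set" where
  "Eud \<sigma> = {letter \<sigma> i | i. i \<in> {1..length \<sigma>} \<and> letter \<sigma> (i - 1) < letter \<sigma> i \<and>
     (\<exists>j \<in> {1..length \<sigma>}. j > i \<and> letter \<sigma> i = letter \<sigma> j \<and> letter \<sigma> j > letter \<sigma> (j + 1))}"

definition asc :: "nat list \<Rightarrow> nat" where "asc \<sigma> = card (Asc \<sigma>)"
definition plat :: "nat list \<Rightarrow> nat" where "plat \<sigma> = card (Plat \<sigma>)"
definition des :: "nat list \<Rightarrow> nat" where "des \<sigma> = card (Des \<sigma>)"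
definition lap :: "nat list \<Rightarrow> nat" where "lap \<sigma> = card (Lap \<sigma>)"
definition rpd :: "nat list \<Rightarrow> nat" where "rpd \<sigma> = card (Rpd \<sigma>)"
definition eud :: "nat list \<Rightarrow> nat" where "eud \<sigma> = card (Eud \<sigma>)"

type_synonym set_stat = "nat list \<Rightarrow> nat set"

definition equidistributed :: "nat \<Rightarrow> set_stat \<times> set_stat \<Rightarrow> set_stat \<times> set_stat \<Rightarrow> bool" where
  "equidistributed n P P' \<longleftrightarrow>
     (\<forall>A B. A \<subseteq> {1..n} \<and> B \<subseteq> {1..n} \<longrightarrow>
        card {\<sigma> \<in> stirling_perms n. fst P \<sigma> = A \<and> snd P \<sigma> = B} =
        card {\<sigma> \<in> stirling_perms n. fst P' \<sigma> = A \<and> snd P' \<sigma> = B})"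

end

theory Submission
  imports Defs
begin

text \<open>
  Every Stirling permutation of order \<open>n + 1\<close> arises exactly once from one of order \<open>n\<close> by
  inserting the factor \<open>m m\<close>, with \<open>m = n + 1\<close>, into one of its \<open>2 n + 1\<close> gaps, the border
  zeros included (\<open>bij_betw_insert_twice\<close>): the two copies of the largest letter are adjacent because
  nothing smaller may stand between them. For \<open>n \<ge> 1\<close> each gap is an ascent, a plateau or a descent.
  The letters in \<open>Asc\<close> are in bijection with the ascent gaps, and likewise \<open>Plat\<close> and \<open>Des\<close> with
  the plateau and the descent gaps, since the Stirling condition prevents a letter from, say,
  ascending twice. Inserting \<open>m m\<close> puts \<open>m\<close> into all three sets and destroys precisely
  the gap that was used. Hence, for \<open>n \<ge> 1\<close>, the triples \<open>(Asc, Plat, Des)\<close> over order \<open>n + 1\<close> come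
  from the triples over order \<open>n\<close> by deleting one letter from one of the three sets, in all
  possible ways, and then adding \<open>m\<close> to each set (\<open>sum_over_insertions\<close>).

  This rule treats the three sets alike, so by induction the joint distribution of the triple is
  invariant under permuting its components (\<open>Asc_Plat_Des_symmetric\<close>). The statistics
  \<open>Lap\<close>, \<open>Rpd\<close> and \<open>Eud\<close> are the pairwise intersections of the three sets, because a letter can
  ascend only at its first copy, descend only at its second copy, and form a plateau only with both.
  So each of the six pairs is of the form \<open>(X, X \<inter> Y)\<close> with distinct \<open>X\<close>, \<open>Y\<close> among
  \<open>Asc\<close>, \<open>Plat\<close>, \<open>Des\<close>, and the symmetry makes them equidistributed.

  All counting is done with sums of an arbitrary function of the statistics, with values in a
  commutative monoid. Indicator functions give equidistribution, monomials give the
  polynomial identities.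
\<close>

section \<open>Letters of a Stirling permutation\<close>

lemma letter_0 [simp]: "letter \<sigma> 0 = 0"
  by (simp add: letter_def)

lemma letter_Suc_length [simp]: "letter \<sigma> (Suc (length \<sigma>)) = 0"
  by (simp add: letter_def nth_append)

lemma letter_Suc: "i < length \<sigma> \<Longrightarrow> letter \<sigma> (Suc i) = \<sigma> ! i"
  by (simp add: letter_def nth_append)

lemma stirling_mset:
  "\<sigma> \<in> stirling_perms n \<Longrightarrow> mset \<sigma> = repeat_mset 2 (mset_set {1..n})"
  by (simp add: stirling_perms_def permutations_of_multiset_def)

lemma stirling_length:
  assumes "\<sigma> \<in> stirling_perms n"
  shows "length \<sigma> = 2 * n"
proof -
  have "size (mset \<sigma>) = 2 * n" unfolding stirling_mset[OF assms] by simp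
  then show ?thesis by simp
qed

lemma stirling_set:
  assumes "\<sigma> \<in> stirling_perms n"
  shows "set \<sigma> = {1..n}"
proof -
  have "v \<in> set \<sigma> \<longleftrightarrow> count (mset \<sigma>) v > 0" for v by simp
  then have "v \<in> set \<sigma> \<longleftrightarrow> v \<in> {1..n}" for v
    unfolding stirling_mset[OF assms] by auto
  then show ?thesis by blast
qed

lemma stirling_letter_in:
  assumes "\<sigma> \<in> stirling_perms n" "1 \<le> i" "i \<le> 2 * n"
  shows "letter \<sigma> i \<in> {1..n}"
proof -
  obtain j where j: "i = Suc j" using assms(2) by (cases i) auto
  have "\<sigma> ! j \<in> set \<sigma>" using assms j by (intro nth_mem) (simp add: stirling_length)
  then show ?thesis using assms j by (simp add: letter_Suc stirling_length stirling_set)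
qed

lemma stirling_letter_le:
  assumes "\<sigma> \<in> stirling_perms n" "i \<le> Suc (2 * n)"
  shows "letter \<sigma> i \<le> n"
proof -
  consider "i = 0" | "1 \<le> i" "i \<le> 2 * n" | "i = Suc (2 * n)" using assms(2) by linarith
  then show ?thesis
  proof cases
    case 2 then show ?thesis using stirling_letter_in[OF assms(1)] by auto
  next
    case 3 then show ?thesis using letter_Suc_length[of \<sigma>] by (simp add: stirling_length[OF assms(1)])
  qed simp
qed

lemma stirling_between:
  assumes "\<sigma> \<in> stirling_perms n" "1 \<le> i" "i < s" "s < j" "j \<le> 2 * n" "letter \<sigma> i = letter \<sigma> j"
  shows "letter \<sigma> s \<ge> letter \<sigma> i"
  using assms unfolding stirling_perms_def by blast

lemma card_positions:
  "card {i \<in> {1..length \<sigma>}. letter \<sigma> i = v} = count (mset \<sigma>) v"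
proof -
  have "{i \<in> {1..length \<sigma>}. letter \<sigma> i = v} = Suc ` {i. i < length \<sigma> \<and> \<sigma> ! i = v}"
  proof (intro equalityI subsetI)
    fix i assume i: "i \<in> {i \<in> {1..length \<sigma>}. letter \<sigma> i = v}"
    then obtain j where "i = Suc j" by (cases i) auto
    then show "i \<in> Suc ` {i. i < length \<sigma> \<and> \<sigma> ! i = v}" using i by (auto simp: letter_Suc)
  qed (auto simp: letter_Suc)
  moreover have "count (mset \<sigma>) v = card {i. i < length \<sigma> \<and> \<sigma> ! i = v}"
    by (auto simp: count_mset count_list_eq_length_filter length_filter_conv_card
        intro!: arg_cong[where f = card])
  ultimately show ?thesis by (simp add: card_image)
qed

lemma stirling_two_positions:
  assumes "\<sigma> \<in> stirling_perms n" "v \<in> {1..n}"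
  obtains a b where "1 \<le> a" "a < b" "b \<le> 2 * n"
    "\<And>i. 1 \<le> i \<Longrightarrow> i \<le> 2 * n \<Longrightarrow> letter \<sigma> i = v \<longleftrightarrow> i = a \<or> i = b"
proof -
  have "card {i \<in> {1..2 * n}. letter \<sigma> i = v} = 2"
    using card_positions[of \<sigma> v] assms(2)
    by (simp add: stirling_mset[OF assms(1)] stirling_length[OF assms(1)])
  then obtain a b where ab: "{i \<in> {1..2 * n}. letter \<sigma> i = v} = {a, b}" "a < b"
    unfolding card_2_iff by (metis insert_commute nat_neq_iff)
  have eq: "i \<in> {1..2 * n} \<and> letter \<sigma> i = v \<longleftrightarrow> i = a \<or> i = b" for i
    using eqset_imp_iff[OF ab(1), of i] by simp
  show ?thesis
    using that[of a b] eq ab(2) by (metis atLeastAtMost_iff)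
qed

section \<open>Ascent, plateau and descent gaps\<close>

text \<open>
  Gap \<open>k\<close> lies between positions \<open>k\<close> and \<open>k + 1\<close>, so that gaps \<open>0\<close> and \<open>length \<sigma>\<close> touch a border
  zero. For words of positive letters, the condition \<open>letter \<sigma> k \<noteq> 0\<close> in \<open>plat_gaps\<close> only discards the single gap of the empty word,
  whose two borders agree without forming a plateau.
\<close>

definition asc_gaps :: "nat list \<Rightarrow> nat set" where
  "asc_gaps \<sigma> = {k. k \<le> length \<sigma> \<and> letter \<sigma> k < letter \<sigma> (Suc k)}"

definition plat_gaps :: "nat list \<Rightarrow> nat set" where
  "plat_gaps \<sigma> = {k. k \<le> length \<sigma> \<and> letter \<sigma> k = letter \<sigma> (Suc k) \<and> letter \<sigma> k \<noteq> 0}"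

definition des_gaps :: "nat list \<Rightarrow> nat set" where
  "des_gaps \<sigma> = {k. k \<le> length \<sigma> \<and> letter \<sigma> k > letter \<sigma> (Suc k)}"

lemma Asc_gaps: "Asc \<sigma> = (\<lambda>k. letter \<sigma> (Suc k)) ` asc_gaps \<sigma>"
proof (intro equalityI subsetI)
  fix v assume "v \<in> Asc \<sigma>"
  then obtain i where i: "v = letter \<sigma> i" "1 \<le> i" "i \<le> length \<sigma>" "letter \<sigma> (i - 1) < letter \<sigma> i"
    by (auto simp: Asc_def)
  then have "i - 1 \<in> asc_gaps \<sigma>" "v = letter \<sigma> (Suc (i - 1))" by (auto simp: asc_gaps_def)
  then show "v \<in> (\<lambda>k. letter \<sigma> (Suc k)) ` asc_gaps \<sigma>" by blast
next
  fix v assume "v \<in> (\<lambda>k. letter \<sigma> (Suc k)) ` asc_gaps \<sigma>"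
  then obtain k where k: "k \<le> length \<sigma>" "letter \<sigma> k < letter \<sigma> (Suc k)" "v = letter \<sigma> (Suc k)"
    by (auto simp: asc_gaps_def)
  have "k \<noteq> length \<sigma>" using k(2) by (metis letter_Suc_length not_less0)
  with k show "v \<in> Asc \<sigma>" by (auto simp: Asc_def intro!: exI[of _ "Suc k"])
qed

lemma Plat_gaps:
  assumes "0 \<notin> set \<sigma>"
  shows "Plat \<sigma> = letter \<sigma> ` plat_gaps \<sigma>"
proof -
  have "letter \<sigma> i \<noteq> 0" if i: "i \<in> {1..length \<sigma>}" for i
  proof -
    obtain j where "i = Suc j" using i by (cases i) auto
    then have "letter \<sigma> i \<in> set \<sigma>" using i by (simp add: letter_Suc)
    then show ?thesis using assms by metis
  qed
  moreover have "1 \<le> i" if "letter \<sigma> i \<noteq> 0" for i using that by (cases i) auto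
  ultimately have "i \<in> plat_gaps \<sigma> \<longleftrightarrow> i \<in> {1..length \<sigma>} \<and> letter \<sigma> i = letter \<sigma> (i + 1)" for i
    unfolding plat_gaps_def by auto
  then show ?thesis unfolding Plat_def by blast
qed

lemma Des_gaps: "Des \<sigma> = letter \<sigma> ` des_gaps \<sigma>"
proof -
  have "1 \<le> k" if "letter \<sigma> k > letter \<sigma> (Suc k)" for k
    using that by (cases k) auto
  then show ?thesis by (force simp: Des_def des_gaps_def)
qed

text \<open>
  A second ascent to the same letter would need a smaller letter just before it, hence between two
  copies of that letter.
\<close>

lemma inj_on_asc_gaps:
  assumes "\<sigma> \<in> stirling_perms n"
  shows "inj_on (\<lambda>k. letter \<sigma> (Suc k)) (asc_gaps \<sigma>)"
proof (rule linorder_inj_onI')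
  fix j k assume jk: "j \<in> asc_gaps \<sigma>" "k \<in> asc_gaps \<sigma>" "j < k"
  show "letter \<sigma> (Suc j) \<noteq> letter \<sigma> (Suc k)"
  proof
    assume eq: "letter \<sigma> (Suc j) = letter \<sigma> (Suc k)"
    have k: "k \<le> 2 * n" "letter \<sigma> k < letter \<sigma> (Suc k)"
      using jk stirling_length[OF assms] by (auto simp: asc_gaps_def)
    have "k \<noteq> 2 * n" using k(2) letter_Suc_length[of \<sigma>] by (auto simp: stirling_length[OF assms])
    moreover have "Suc j < k" using jk eq k by (metis Suc_lessI nat_neq_iff)
    ultimately show False
      using stirling_between[OF assms, of "Suc j" k "Suc k"] jk eq k by auto
  qed
qed

lemma inj_on_des_gaps:
  assumes "\<sigma> \<in> stirling_perms n"
  shows "inj_on (letter \<sigma>) (des_gaps \<sigma>)"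
proof (rule linorder_inj_onI')
  fix j k assume jk: "j \<in> des_gaps \<sigma>" "k \<in> des_gaps \<sigma>" "j < k"
  show "letter \<sigma> j \<noteq> letter \<sigma> k"
  proof
    assume eq: "letter \<sigma> j = letter \<sigma> k"
    have j: "k \<le> 2 * n" "letter \<sigma> j > letter \<sigma> (Suc j)"
      using jk stirling_length[OF assms] by (auto simp: des_gaps_def)
    have "j \<noteq> 0" using j(2) by (metis letter_0 not_less0)
    moreover have "Suc j < k" using jk eq j by (metis Suc_lessI nat_neq_iff)
    ultimately show False
      using stirling_between[OF assms, of j "Suc j" k] jk eq j by auto
  qed
qed

lemma stirling_no_zero: "\<sigma> \<in> stirling_perms n \<Longrightarrow> 0 \<notin> set \<sigma>"
  by (simp add: stirling_set)

lemma plat_gap_letter: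
  assumes "\<sigma> \<in> stirling_perms n" "k \<in> plat_gaps \<sigma>"
  shows "1 \<le> k" "Suc k \<le> 2 * n" "letter \<sigma> (Suc k) = letter \<sigma> k" "letter \<sigma> k \<in> {1..n}"
proof -
  have k: "k \<le> 2 * n" "letter \<sigma> (Suc k) = letter \<sigma> k" "letter \<sigma> k \<noteq> 0"
    using assms(2) stirling_length[OF assms(1)] by (auto simp: plat_gaps_def)
  then show "1 \<le> k" "letter \<sigma> (Suc k) = letter \<sigma> k" by (cases k; auto)+
  then show v: "letter \<sigma> k \<in> {1..n}" using stirling_letter_in[OF assms(1)] k by blast
  have "k \<noteq> 2 * n"
    using k letter_Suc_length[of \<sigma>] by (auto simp: stirling_length[OF assms(1)])
  then show "Suc k \<le> 2 * n" using k by linarith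
qed

text \<open>
  Two plateaus of the same letter would take at least three copies of it.
\<close>

lemma inj_on_plat_gaps:
  assumes "\<sigma> \<in> stirling_perms n"
  shows "inj_on (letter \<sigma>) (plat_gaps \<sigma>)"
proof (rule inj_onI)
  fix j k assume jk: "j \<in> plat_gaps \<sigma>" "k \<in> plat_gaps \<sigma>" "letter \<sigma> j = letter \<sigma> k"
  note j = plat_gap_letter[OF assms jk(1)] and k = plat_gap_letter[OF assms jk(2)]
  obtain a b where "a < b"
    and ab: "\<And>i. 1 \<le> i \<Longrightarrow> i \<le> 2 * n \<Longrightarrow> letter \<sigma> i = letter \<sigma> k \<longleftrightarrow> i = a \<or> i = b"
    by (rule stirling_two_positions[OF assms k(4)]) blast
  then show "j = k"
    using ab[of j] ab[of "Suc j"] ab[of k] ab[of "Suc k"] j k jk(3) by auto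
qed

lemma gaps_partition:
  assumes "\<sigma> \<in> stirling_perms n" "n \<ge> 1"
  shows "{..2 * n} = asc_gaps \<sigma> \<union> plat_gaps \<sigma> \<union> des_gaps \<sigma>"
proof -
  have "letter \<sigma> k \<noteq> 0 \<or> letter \<sigma> (Suc k) \<noteq> 0" if "k \<le> 2 * n" for k
    using stirling_letter_in[OF assms(1), of k] stirling_letter_in[OF assms(1), of 1] assms(2) that
    by (cases k) auto
  then show ?thesis
    unfolding asc_gaps_def plat_gaps_def des_gaps_def stirling_length[OF assms(1)]
    by (fastforce simp: not_less)
qed

section \<open>Lap, Rpd and Eud as intersections\<close>

text \<open>
  With only two copies available, the ascent of a common letter lies at one of the two positions of
  its plateau. It is not the second one, whose predecessor is equal to it.
\<close>

lemma Lap_eq: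
  assumes "\<sigma> \<in> stirling_perms n"
  shows "Lap \<sigma> = Asc \<sigma> \<inter> Plat \<sigma>"
proof
  show "Lap \<sigma> \<subseteq> Asc \<sigma> \<inter> Plat \<sigma>" unfolding Lap_def Asc_def Plat_def by blast
  show "Asc \<sigma> \<inter> Plat \<sigma> \<subseteq> Lap \<sigma>"
  proof
    fix v assume v: "v \<in> Asc \<sigma> \<inter> Plat \<sigma>"
    obtain i where i: "v = letter \<sigma> i" "1 \<le> i" "i \<le> 2 * n" "letter \<sigma> (i - 1) < letter \<sigma> i"
      using v by (auto simp: Asc_def stirling_length[OF assms])
    obtain j where j: "j \<in> plat_gaps \<sigma>" "v = letter \<sigma> j" using v by (auto simp: Plat_gaps[OF stirling_no_zero[OF assms]])
    note J = plat_gap_letter[OF assms j(1)]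
    obtain a b where "a < b"
      and ab: "\<And>i. 1 \<le> i \<Longrightarrow> i \<le> 2 * n \<Longrightarrow> letter \<sigma> i = letter \<sigma> j \<longleftrightarrow> i = a \<or> i = b"
      by (rule stirling_two_positions[OF assms J(4)]) blast
    then have "i = j \<or> i = Suc j"
      using ab[of i] ab[of j] ab[of "Suc j"] i j J by auto
    moreover have "i \<noteq> Suc j" using i j J by auto
    ultimately show "v \<in> Lap \<sigma>"
      using i J stirling_length[OF assms] by (auto simp: Lap_def)
  qed
qed

lemma Rpd_eq:
  assumes "\<sigma> \<in> stirling_perms n"
  shows "Rpd \<sigma> = Plat \<sigma> \<inter> Des \<sigma>"
proof
  show "Rpd \<sigma> \<subseteq> Plat \<sigma> \<inter> Des \<sigma>"
  proof
    fix v assume "v \<in> Rpd \<sigma>"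
    then obtain i where i: "v = letter \<sigma> i" "1 \<le> i" "i \<le> 2 * n"
      "letter \<sigma> (i - 1) = letter \<sigma> i" "letter \<sigma> i > letter \<sigma> (i + 1)"
      by (auto simp: Rpd_def stirling_length[OF assms])
    then have "i - 1 \<in> plat_gaps \<sigma>" "i \<in> des_gaps \<sigma>"
      by (auto simp: plat_gaps_def des_gaps_def stirling_length[OF assms])
    moreover have "v = letter \<sigma> (i - 1)" using i by simp
    ultimately show "v \<in> Plat \<sigma> \<inter> Des \<sigma>"
      using i(1) unfolding Plat_gaps[OF stirling_no_zero[OF assms]] Des_gaps by blast
  qed
  show "Plat \<sigma> \<inter> Des \<sigma> \<subseteq> Rpd \<sigma>"
  proof
    fix v assume v: "v \<in> Plat \<sigma> \<inter> Des \<sigma>"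
    obtain i where i: "v = letter \<sigma> i" "1 \<le> i" "i \<le> 2 * n" "letter \<sigma> i > letter \<sigma> (i + 1)"
      using v by (auto simp: Des_def stirling_length[OF assms])
    obtain j where j: "j \<in> plat_gaps \<sigma>" "v = letter \<sigma> j" using v by (auto simp: Plat_gaps[OF stirling_no_zero[OF assms]])
    note J = plat_gap_letter[OF assms j(1)]
    obtain a b where "a < b"
      and ab: "\<And>i. 1 \<le> i \<Longrightarrow> i \<le> 2 * n \<Longrightarrow> letter \<sigma> i = letter \<sigma> j \<longleftrightarrow> i = a \<or> i = b"
      by (rule stirling_two_positions[OF assms J(4)]) blast
    then have "i = j \<or> i = Suc j"
      using ab[of i] ab[of j] ab[of "Suc j"] i j J by auto
    moreover have "i \<noteq> j" using i j J by auto
    ultimately have "i = Suc j" by blast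
    then show "v \<in> Rpd \<sigma>"
      using i J stirling_length[OF assms] unfolding Rpd_def by (intro CollectI exI[of _ i]) auto
  qed
qed

text \<open>
  The ascent must be at the first copy of the letter and the descent at the second, since a smaller
  letter may not be adjacent to a copy on the side facing the other copy. This gives the order of
  positions demanded by \<open>Eud\<close>.
\<close>

lemma Eud_eq:
  assumes "\<sigma> \<in> stirling_perms n"
  shows "Eud \<sigma> = Asc \<sigma> \<inter> Des \<sigma>"
proof
  show "Eud \<sigma> \<subseteq> Asc \<sigma> \<inter> Des \<sigma>" unfolding Eud_def Asc_def Des_def by blast
  show "Asc \<sigma> \<inter> Des \<sigma> \<subseteq> Eud \<sigma>"
  proof
    fix v assume v: "v \<in> Asc \<sigma> \<inter> Des \<sigma>"
    obtain i where i: "v = letter \<sigma> i" "1 \<le> i" "i \<le> 2 * n" "letter \<sigma> (i - 1) < letter \<sigma> i"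
      using v by (auto simp: Asc_def stirling_length[OF assms])
    obtain j where j: "v = letter \<sigma> j" "1 \<le> j" "j \<le> 2 * n" "letter \<sigma> j > letter \<sigma> (j + 1)"
      using v by (auto simp: Des_def stirling_length[OF assms])
    have v_in: "v \<in> {1..n}" using stirling_letter_in[OF assms] i by blast
    obtain a b where "1 \<le> a" "a < b" "b \<le> 2 * n"
      and ab: "\<And>i. 1 \<le> i \<Longrightarrow> i \<le> 2 * n \<Longrightarrow> letter \<sigma> i = v \<longleftrightarrow> i = a \<or> i = b"
      by (rule stirling_two_positions[OF assms v_in]) blast
    have la: "letter \<sigma> a = v" and lb: "letter \<sigma> b = v"
      using ab[of a] ab[of b] \<open>1 \<le> a\<close> \<open>a < b\<close> \<open>b \<le> 2 * n\<close> by linarith+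
    have inner: "letter \<sigma> s \<ge> v" if "a \<le> s" "s \<le> b" for s
    proof (cases "s = a \<or> s = b")
      case True then show ?thesis using la lb by auto
    next
      case False
      then show ?thesis using stirling_between[OF assms, of a s b] that la lb \<open>1 \<le> a\<close> \<open>b \<le> 2 * n\<close> by auto
    qed
    have "a \<le> b - 1" "a + 1 \<le> b" using \<open>a < b\<close> by linarith+
    then have "letter \<sigma> (b - 1) \<ge> v" "letter \<sigma> (a + 1) \<ge> v" by (auto intro: inner)
    then have "i \<noteq> b" "j \<noteq> a" using i j by auto
    then have "i = a" "j = b" using ab[of i] ab[of j] i j by auto
    then show "v \<in> Eud \<sigma>"
      using i j \<open>a < b\<close> unfolding Eud_def
      by (intro CollectI exI[of _ i]) (auto simp: stirling_length[OF assms] intro!: bexI[of _ j])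
  qed
qed

section \<open>Inserting two adjacent copies of a new letter\<close>

definition insert_twice :: "nat \<Rightarrow> nat \<Rightarrow> nat list \<Rightarrow> nat list" where
  "insert_twice m k \<sigma> = take k \<sigma> @ m # m # drop k \<sigma>"

lemma length_insert_twice [simp]: "length (insert_twice m k \<sigma>) = length \<sigma> + 2"
  by (simp add: insert_twice_def)

lemma mset_insert_twice: "mset (insert_twice m k \<sigma>) = add_mset m (add_mset m (mset \<sigma>))"
proof -
  have "mset (take k \<sigma>) + mset (drop k \<sigma>) = mset \<sigma>"
    by (metis append_take_drop_id mset_append)
  then show ?thesis by (simp add: insert_twice_def)
qed

lemma letter_insert_twice:
  assumes "k \<le> length \<sigma>" "j \<le> length \<sigma> + 3"
  shows "letter (insert_twice m k \<sigma>) j =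
    (if j \<le> k then letter \<sigma> j else if j \<le> k + 2 then m else letter \<sigma> (j - 2))"
proof -
  let ?w = "0 # \<sigma> @ [0]"
  have "0 # insert_twice m k \<sigma> @ [0] = take (Suc k) ?w @ [m, m] @ drop (Suc k) ?w"
    using assms(1) by (simp add: insert_twice_def)
  then have L: "letter (insert_twice m k \<sigma>) j = (take (Suc k) ?w @ [m, m] @ drop (Suc k) ?w) ! j"
    by (simp only: letter_def)
  consider "j \<le> k" | "j = k + 1" | "j = k + 2" | "j > k + 2" by linarith
  then show ?thesis
  proof cases
    case 4
    then obtain i where "j = k + 3 + i" by (metis add.commute less_imp_add_positive
      Suc_leI le_Suc_ex numeral_2_eq_2 numeral_3_eq_3 add_Suc_right)
    then show ?thesis using assms unfolding L by (auto simp: letter_def nth_append)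
  qed (use assms in \<open>unfold L, auto simp: letter_def nth_append min_def simp del: take_Suc_Cons drop_Suc_Cons\<close>)
qed

text \<open>
  Insertion replaces the gap \<open>k\<close> by the three gaps around and between the new letters and keeps
  all others. Stating this for an arbitrary relation \<open>R\<close> serves ascents, plateaus and descents alike.
\<close>

lemma ex_gap_insert_twice:
  fixes m :: nat
  assumes "k \<le> length \<sigma>"
  defines "\<tau> \<equiv> insert_twice m k \<sigma>"
  shows "(\<exists>j \<le> length \<tau>. R (letter \<tau> j) (letter \<tau> (Suc j))) \<longleftrightarrow>
    R (letter \<sigma> k) m \<or> R m m \<or> R m (letter \<sigma> (Suc k)) \<or>
    (\<exists>j \<le> length \<sigma>. j \<noteq> k \<and> R (letter \<sigma> j) (letter \<sigma> (Suc j)))"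
    (is "?L \<longleftrightarrow> ?R")
proof
  have \<tau>: "letter \<tau> j = (if j \<le> k then letter \<sigma> j else if j \<le> k + 2 then m else letter \<sigma> (j - 2))"
    if "j \<le> length \<sigma> + 3" for j
    using letter_insert_twice[OF assms(1) that] by (simp add: \<tau>_def)
  have len: "length \<tau> = length \<sigma> + 2" by (simp add: \<tau>_def)
  { assume ?L
    then obtain j where j: "j \<le> length \<sigma> + 2" "R (letter \<tau> j) (letter \<tau> (Suc j))"
      by (auto simp: \<tau>_def)
    consider "j < k" | "j \<in> {k, k + 1, k + 2}" | i where "j = i + 2" "k < i"
      using that(1) that(2) that(3)[of "j - 2"] by fastforce
    then show ?R
    proof cases
      case 1
      then have "R (letter \<sigma> j) (letter \<sigma> (Suc j))" "j \<noteq> k" "j \<le> length \<sigma>"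
        using j assms(1) by (auto simp: \<tau>)
      then show ?thesis by blast
    next
      case 2 then show ?thesis using j assms(1) by (auto simp: \<tau>)
    next
      case 3 then show ?thesis using j by (auto simp: \<tau>)
    qed }
  { assume ?R
    then consider "R (letter \<sigma> k) m" | "R m m" | "R m (letter \<sigma> (Suc k))"
      | j where "j < k" "R (letter \<sigma> j) (letter \<sigma> (Suc j))"
      | j where "k < j" "j \<le> length \<sigma>" "R (letter \<sigma> j) (letter \<sigma> (Suc j))"
      by (metis nat_neq_iff)
    then show ?L
    proof cases
      case 1 then show ?thesis using assms(1) by (intro exI[of _ k]) (auto simp: \<tau> len)
    next
      case 2 then show ?thesis using assms(1) by (intro exI[of _ "k + 1"]) (auto simp: \<tau> len)
    next
      case 3 then show ?thesis using assms(1) by (intro exI[of _ "k + 2"]) (auto simp: \<tau> len)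
    next
      case (4 j) then show ?thesis using assms(1) by (intro exI[of _ j]) (auto simp: \<tau> len)
    next
      case (5 j) then show ?thesis using assms(1) by (intro exI[of _ "j + 2"]) (auto simp: \<tau> len)
    qed }
qed

text \<open>
  When the new letter exceeds all others, each of the three new gaps has a different type, so the
  new letter joins each of the three sets and nothing else is gained.
\<close>

lemma Asc_insert_twice:
  assumes "k \<le> length \<sigma>" "\<And>i. i \<le> Suc (length \<sigma>) \<Longrightarrow> letter \<sigma> i < m"
  shows "Asc (insert_twice m k \<sigma>) = insert m ((\<lambda>j. letter \<sigma> (Suc j)) ` (asc_gaps \<sigma> - {k}))"
proof (rule set_eqI)
  fix v
  have "letter \<sigma> k < m" "\<not> m < letter \<sigma> (Suc k)" using assms(2)[of k] assms(2)[of "Suc k"] assms(1) by auto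
  then show "v \<in> Asc (insert_twice m k \<sigma>) \<longleftrightarrow> v \<in> insert m ((\<lambda>j. letter \<sigma> (Suc j)) ` (asc_gaps \<sigma> - {k}))"
    using ex_gap_insert_twice[OF assms(1), of m "\<lambda>a b. a < b \<and> v = b"]
    unfolding Asc_gaps asc_gaps_def by blast
qed

lemma Des_insert_twice:
  assumes "k \<le> length \<sigma>" "\<And>i. i \<le> Suc (length \<sigma>) \<Longrightarrow> letter \<sigma> i < m"
  shows "Des (insert_twice m k \<sigma>) = insert m (letter \<sigma> ` (des_gaps \<sigma> - {k}))"
proof (rule set_eqI)
  fix v
  have "\<not> m < letter \<sigma> k" "letter \<sigma> (Suc k) < m" using assms(2)[of k] assms(2)[of "Suc k"] assms(1) by auto
  then show "v \<in> Des (insert_twice m k \<sigma>) \<longleftrightarrow> v \<in> insert m (letter \<sigma> ` (des_gaps \<sigma> - {k}))"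
    using ex_gap_insert_twice[OF assms(1), of m "\<lambda>a b. b < a \<and> v = a"]
    unfolding Des_gaps des_gaps_def by blast
qed

lemma Plat_insert_twice:
  assumes "k \<le> length \<sigma>" "\<And>i. i \<le> Suc (length \<sigma>) \<Longrightarrow> letter \<sigma> i < m" "0 \<notin> set \<sigma>"
  shows "Plat (insert_twice m k \<sigma>) = insert m (letter \<sigma> ` (plat_gaps \<sigma> - {k}))"
proof (rule set_eqI)
  fix v
  have m: "letter \<sigma> k \<noteq> m" "m \<noteq> letter \<sigma> (Suc k)" "m \<noteq> 0"
    using assms(2)[of k] assms(2)[of "Suc k"] assms(1) by auto
  have "set (insert_twice m k \<sigma>) = insert m (set \<sigma>)"
    using arg_cong[OF mset_insert_twice[of m k \<sigma>], of set_mset] by simp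
  then have "0 \<notin> set (insert_twice m k \<sigma>)" using m(3) assms(3) by simp
  then show "v \<in> Plat (insert_twice m k \<sigma>) \<longleftrightarrow> v \<in> insert m (letter \<sigma> ` (plat_gaps \<sigma> - {k}))"
    using m ex_gap_insert_twice[OF assms(1), of m "\<lambda>a b. a = b \<and> a \<noteq> 0 \<and> v = a"]
    unfolding Plat_gaps[OF \<open>0 \<notin> set (insert_twice m k \<sigma>)\<close>] plat_gaps_def by blast
qed

section \<open>Every Stirling permutation arises by insertion\<close>

lemma repeat_mset_Suc_interval:
  "repeat_mset 2 (mset_set {1..Suc n}) =
     add_mset (Suc n) (add_mset (Suc n) (repeat_mset 2 (mset_set {1..n})))"
proof -
  have "mset_set {1..Suc n} = add_mset (Suc n) (mset_set {1..n})"
    by (simp add: atLeastAtMostSuc_conv)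
  then show ?thesis by (simp add: numeral_2_eq_2)
qed

lemma stirling_permsI:
  assumes "mset \<sigma> = repeat_mset 2 (mset_set {1..n})"
    and "\<And>i s j. 1 \<le> i \<Longrightarrow> i < s \<Longrightarrow> s < j \<Longrightarrow> j \<le> 2 * n \<Longrightarrow> letter \<sigma> i = letter \<sigma> j
          \<Longrightarrow> letter \<sigma> s \<ge> letter \<sigma> i"
  shows "\<sigma> \<in> stirling_perms n"
  using assms by (auto simp: stirling_perms_def permutations_of_multiset_def)

lemma insert_twice_in_stirling:
  assumes "\<sigma> \<in> stirling_perms n" "k \<le> 2 * n"
  shows "insert_twice (Suc n) k \<sigma> \<in> stirling_perms (Suc n)"
proof (rule stirling_permsI)
  show "mset (insert_twice (Suc n) k \<sigma>) = repeat_mset 2 (mset_set {1..Suc n})"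
    unfolding repeat_mset_Suc_interval mset_insert_twice stirling_mset[OF assms(1)] ..
next
  fix i s j
  assume A: "1 \<le> i" "i < s" "s < j" "j \<le> 2 * Suc n"
    and eq: "letter (insert_twice (Suc n) k \<sigma>) i = letter (insert_twice (Suc n) k \<sigma>) j"
  \<comment> \<open>The position in the old word of the letter at position \<open>i\<close> of the new one, if that is not an
    inserted letter.\<close>
  let ?d = "\<lambda>i. if i \<le> k then i else i - 2"
  let ?new = "\<lambda>i. k < i \<and> i \<le> k + 2"
  have L: "letter (insert_twice (Suc n) k \<sigma>) i = (if ?new i then Suc n else letter \<sigma> (?d i))"
    if "i \<le> 2 * n + 3" for i
    using letter_insert_twice[of k \<sigma> i "Suc n"] that assms stirling_length[OF assms(1)] by auto
  have le: "letter \<sigma> (?d i) \<le> n" if "i \<le> 2 * n + 2" for i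
    using stirling_letter_le[OF assms(1), of "?d i"] that assms(2) by auto
  show "letter (insert_twice (Suc n) k \<sigma>) i \<le> letter (insert_twice (Suc n) k \<sigma>) s"
  proof (cases "?new s")
    case True
    then show ?thesis using L[of s] L[of i] le[of i] A by auto
  next
    case False
    then have not_new: "\<not> ?new i" "\<not> ?new j"
      using eq L[of i] L[of j] le[of i] le[of j] A by (auto split: if_splits)
    have "letter \<sigma> (?d i) \<le> letter \<sigma> (?d s)"
    proof (rule stirling_between[OF assms(1)])
      show "letter \<sigma> (?d i) = letter \<sigma> (?d j)" using eq L[of i] L[of j] not_new A by auto
    qed (use A not_new False assms(2) in auto)
    then show ?thesis using L[of i] L[of s] not_new False A by auto
  qed
qed

text \<open>
  Between the two copies of the largest letter only that letter could stand, and there is no third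
  copy. So the two are adjacent and can be removed.
\<close>

lemma stirling_Suc_is_insert_twice:
  assumes "\<tau> \<in> stirling_perms (Suc n)"
  shows "\<exists>k \<le> 2 * n. \<exists>\<sigma> \<in> stirling_perms n. \<tau> = insert_twice (Suc n) k \<sigma>"
proof -
  have len: "length \<tau> = 2 * n + 2" using stirling_length[OF assms] by simp
  obtain a b where ab: "1 \<le> a" "a < b" "b \<le> 2 * n + 2"
    and pos: "\<And>i. 1 \<le> i \<Longrightarrow> i \<le> 2 * n + 2 \<Longrightarrow> letter \<tau> i = Suc n \<longleftrightarrow> i = a \<or> i = b"
    using stirling_two_positions[OF assms, of "Suc n"] by auto
  have la: "letter \<tau> a = Suc n" "letter \<tau> b = Suc n" using pos[of a] pos[of b] ab by auto
  have b: "b = Suc a"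
  proof (rule ccontr)
    assume "b \<noteq> Suc a"
    then have "letter \<tau> (Suc a) \<ge> Suc n"
      using stirling_between[OF assms, of a "Suc a" b] la ab by auto
    moreover have "letter \<tau> (Suc a) \<le> Suc n" using stirling_letter_le[OF assms] ab by auto
    ultimately show False using pos[of "Suc a"] ab \<open>b \<noteq> Suc a\<close> by auto
  qed
  define k where "k = a - 1"
  define \<sigma> where "\<sigma> = take k \<tau> @ drop (k + 2) \<tau>"
  have k: "k \<le> 2 * n" and lk: "\<tau> ! k = Suc n" "\<tau> ! Suc k = Suc n"
    using ab b la len letter_Suc[of k \<tau>] letter_Suc[of "Suc k" \<tau>] by (auto simp: k_def)
  have "\<tau> = take k \<tau> @ \<tau> ! k # \<tau> ! Suc k # drop (k + 2) \<tau>"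
    using id_take_nth_drop[of k \<tau>] Cons_nth_drop_Suc[of "Suc k" \<tau>] k len by simp
  then have \<tau>: "\<tau> = insert_twice (Suc n) k \<sigma>"
    using k len lk by (simp add: insert_twice_def \<sigma>_def)
  have len\<sigma>: "length \<sigma> = 2 * n" using len length_insert_twice[of "Suc n" k \<sigma>] \<tau> by simp
  have "\<sigma> \<in> stirling_perms n"
  proof (rule stirling_permsI)
    have "add_mset (Suc n) (add_mset (Suc n) (mset \<sigma>)) = mset \<tau>" by (simp add: \<tau> mset_insert_twice)
    then show "mset \<sigma> = repeat_mset 2 (mset_set {1..n})"
      unfolding stirling_mset[OF assms] repeat_mset_Suc_interval by simp
  next
    fix i s j
    assume A: "1 \<le> i" "i < s" "s < j" "j \<le> 2 * n" "letter \<sigma> i = letter \<sigma> j"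
    let ?u = "\<lambda>i. if i \<le> k then i else i + 2"
    have L: "letter \<sigma> i = letter \<tau> (?u i)" if "i \<le> 2 * n" for i
      using letter_insert_twice[of k \<sigma> "?u i" "Suc n"] that k len\<sigma> \<tau> by auto
    have "letter \<tau> (?u i) \<le> letter \<tau> (?u s)"
      by (rule stirling_between[OF assms, of _ _ "?u j"]) (use A L[of i] L[of j] in auto)
    then show "letter \<sigma> i \<le> letter \<sigma> s" using L[of i] L[of s] A by auto
  qed
  with k \<tau> show ?thesis by blast
qed

lemma bij_betw_insert_twice:
  "bij_betw (\<lambda>(\<sigma>, k). insert_twice (Suc n) k \<sigma>) (stirling_perms n \<times> {..2 * n}) (stirling_perms (Suc n))"
proof (rule bij_betw_imageI)
  show "inj_on (\<lambda>(\<sigma>, k). insert_twice (Suc n) k \<sigma>) (stirling_perms n \<times> {..2 * n})"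
  proof (rule inj_onI)
    fix p q
    assume p: "p \<in> stirling_perms n \<times> {..2 * n}" and q: "q \<in> stirling_perms n \<times> {..2 * n}"
      and pq: "(\<lambda>(\<sigma>, k). insert_twice (Suc n) k \<sigma>) p = (\<lambda>(\<sigma>, k). insert_twice (Suc n) k \<sigma>) q"
    obtain \<sigma> k \<tau> l where pq_eq: "p = (\<sigma>, k)" "q = (\<tau>, l)" by (metis surj_pair)
    have \<sigma>: "\<sigma> \<in> stirling_perms n" "k \<in> {..2 * n}" and \<tau>: "\<tau> \<in> stirling_perms n" "l \<in> {..2 * n}"
      and eq: "insert_twice (Suc n) k \<sigma> = insert_twice (Suc n) l \<tau>"
      using p q pq by (auto simp: pq_eq)
    \<comment> \<open>The insertion point is recovered as the first occurrence of the new letter.\<close>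
    have split: "take k \<rho> = takeWhile (\<lambda>x. x \<noteq> Suc n) (insert_twice (Suc n) k \<rho>)" "Suc n \<notin> set \<rho>"
      if "\<rho> \<in> stirling_perms n" for k \<rho>
    proof -
      show notin: "Suc n \<notin> set \<rho>" using stirling_set[OF that] by simp
      have "\<forall>x \<in> set (take k \<rho>). x \<noteq> Suc n" using notin set_take_subset[of k \<rho>] by blast
      then show "take k \<rho> = takeWhile (\<lambda>x. x \<noteq> Suc n) (insert_twice (Suc n) k \<rho>)"
        by (simp add: insert_twice_def takeWhile_append2)
    qed
    have take: "take k \<sigma> = take l \<tau>" using split[OF \<sigma>(1)] split[OF \<tau>(1)] eq by simp
    then have drop: "drop k \<sigma> = drop l \<tau>" using eq by (simp add: insert_twice_def)
    have "k = l"
      using arg_cong[OF take, of length] \<sigma> \<tau> by (simp add: stirling_length)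
    moreover have "\<sigma> = \<tau>" using take drop by (metis append_take_drop_id)
    ultimately show "p = q" by (simp add: pq_eq)
  qed
  show "(\<lambda>(\<sigma>, k). insert_twice (Suc n) k \<sigma>) ` (stirling_perms n \<times> {..2 * n}) = stirling_perms (Suc n)"
    using insert_twice_in_stirling stirling_Suc_is_insert_twice by (fastforce simp: image_iff)
qed

section \<open>Symmetry of the joint distribution\<close>

text \<open>
  The gaps are sorted by type, and each class of gaps is then indexed by the letters of the matching
  statistic. The right-hand side is symmetric in the three statistics up to the order of the
  arguments of \<open>F\<close>.
\<close>

lemma sum_over_insertions:
  fixes F :: "nat set \<Rightarrow> nat set \<Rightarrow> nat set \<Rightarrow> 'b :: comm_monoid_add"
  assumes "\<sigma> \<in> stirling_perms n" "n \<ge> 1"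
  defines "m \<equiv> Suc n"
  shows "(\<Sum>k\<le>2 * n. F (Asc (insert_twice m k \<sigma>)) (Plat (insert_twice m k \<sigma>)) (Des (insert_twice m k \<sigma>))) =
    (\<Sum>v\<in>Asc \<sigma>. F (insert m (Asc \<sigma> - {v})) (insert m (Plat \<sigma>)) (insert m (Des \<sigma>))) +
    (\<Sum>v\<in>Plat \<sigma>. F (insert m (Asc \<sigma>)) (insert m (Plat \<sigma> - {v})) (insert m (Des \<sigma>))) +
    (\<Sum>v\<in>Des \<sigma>. F (insert m (Asc \<sigma>)) (insert m (Plat \<sigma>)) (insert m (Des \<sigma> - {v})))"
proof -
  let ?f = "\<lambda>k. F (Asc (insert_twice m k \<sigma>)) (Plat (insert_twice m k \<sigma>)) (Des (insert_twice m k \<sigma>))"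
  have nz: "0 \<notin> set \<sigma>" using stirling_no_zero[OF assms(1)] .
  note part = gaps_partition[OF assms(1,2)]
  have disj: "asc_gaps \<sigma> \<inter> plat_gaps \<sigma> = {}" "(asc_gaps \<sigma> \<union> plat_gaps \<sigma>) \<inter> des_gaps \<sigma> = {}"
    by (auto simp: asc_gaps_def plat_gaps_def des_gaps_def)
  have fin: "finite (asc_gaps \<sigma>)" "finite (plat_gaps \<sigma>)" "finite (des_gaps \<sigma>)"
    by (auto simp: asc_gaps_def plat_gaps_def des_gaps_def)
  have letters: "letter \<sigma> i < m" if "i \<le> Suc (length \<sigma>)" for i
    using stirling_letter_le[OF assms(1), of i] that by (simp add: m_def stirling_length[OF assms(1)])
  have A: "Asc (insert_twice m k \<sigma>) = insert m (Asc \<sigma> - (if k \<in> asc_gaps \<sigma> then {letter \<sigma> (Suc k)} else {}))"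
    if "k \<le> 2 * n" for k
    using Asc_insert_twice[of k \<sigma> m] that letters inj_on_image_set_diff[OF inj_on_asc_gaps[OF assms(1)], of "asc_gaps \<sigma>" "{k}"]
    by (auto simp: stirling_length[OF assms(1)] Asc_gaps)
  have P: "Plat (insert_twice m k \<sigma>) = insert m (Plat \<sigma> - (if k \<in> plat_gaps \<sigma> then {letter \<sigma> k} else {}))"
    if "k \<le> 2 * n" for k
    using Plat_insert_twice[of k \<sigma> m] nz that letters inj_on_image_set_diff[OF inj_on_plat_gaps[OF assms(1)], of "plat_gaps \<sigma>" "{k}"]
    by (auto simp: stirling_length[OF assms(1)] Plat_gaps)
  have D: "Des (insert_twice m k \<sigma>) = insert m (Des \<sigma> - (if k \<in> des_gaps \<sigma> then {letter \<sigma> k} else {}))"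
    if "k \<le> 2 * n" for k
    using Des_insert_twice[of k \<sigma> m] that letters inj_on_image_set_diff[OF inj_on_des_gaps[OF assms(1)], of "des_gaps \<sigma>" "{k}"]
    by (auto simp: stirling_length[OF assms(1)] Des_gaps)
  have "(\<Sum>k\<le>2 * n. ?f k) = sum ?f (asc_gaps \<sigma>) + sum ?f (plat_gaps \<sigma>) + sum ?f (des_gaps \<sigma>)"
    unfolding part using disj fin by (simp add: sum.union_disjoint)
  moreover have "sum ?f (asc_gaps \<sigma>) =
    (\<Sum>v\<in>Asc \<sigma>. F (insert m (Asc \<sigma> - {v})) (insert m (Plat \<sigma>)) (insert m (Des \<sigma>)))"
    unfolding Asc_gaps[of \<sigma>] sum.reindex[OF inj_on_asc_gaps[OF assms(1)]]
    unfolding Asc_gaps[of \<sigma>, symmetric]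
    using part disj by (intro sum.cong refl) (auto simp: A P D set_eq_iff[of "{..2*n}"])
  moreover have "sum ?f (plat_gaps \<sigma>) =
    (\<Sum>v\<in>Plat \<sigma>. F (insert m (Asc \<sigma>)) (insert m (Plat \<sigma> - {v})) (insert m (Des \<sigma>)))"
    unfolding Plat_gaps[OF nz] sum.reindex[OF inj_on_plat_gaps[OF assms(1)]]
    unfolding Plat_gaps[OF nz, symmetric]
    using part disj by (intro sum.cong refl) (auto simp: A P D set_eq_iff[of "{..2*n}"])
  moreover have "sum ?f (des_gaps \<sigma>) =
    (\<Sum>v\<in>Des \<sigma>. F (insert m (Asc \<sigma>)) (insert m (Plat \<sigma>)) (insert m (Des \<sigma> - {v})))"
    unfolding Des_gaps[of \<sigma>] sum.reindex[OF inj_on_des_gaps[OF assms(1)]]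
    unfolding Des_gaps[of \<sigma>, symmetric]
    using part disj by (intro sum.cong refl) (auto simp: A P D set_eq_iff[of "{..2*n}"])
  ultimately show ?thesis by simp
qed

lemma sum_stirling_perms_Suc:
  "(\<Sum>\<sigma>\<in>stirling_perms (Suc n). f \<sigma>) = (\<Sum>\<sigma>\<in>stirling_perms n. \<Sum>k\<le>2 * n. f (insert_twice (Suc n) k \<sigma>))"
  by (simp add: sum.cartesian_product sum.reindex_bij_betw[OF bij_betw_insert_twice, symmetric] case_prod_unfold)

lemma stirling_perms_0: "stirling_perms 0 = {[]}"
  by (auto simp: stirling_perms_def)

text \<open>
  The two transpositions generate all permutations of the three statistics. The function \<open>F\<close> has to
  be arbitrary in the induction: the hypothesis is applied to the recursion's right-hand side, as a
  function \<open>?G F\<close> of the triple. The empty word has no ascent, plateau or descent although it has a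
  gap, so the step from order \<open>0\<close> to order \<open>1\<close> is done by hand.
\<close>

lemma Asc_Plat_Des_symmetric:
  fixes F :: "nat set \<Rightarrow> nat set \<Rightarrow> nat set \<Rightarrow> 'b :: comm_monoid_add"
  shows "(\<Sum>\<sigma>\<in>stirling_perms n. F (Asc \<sigma>) (Plat \<sigma>) (Des \<sigma>)) =
           (\<Sum>\<sigma>\<in>stirling_perms n. F (Plat \<sigma>) (Asc \<sigma>) (Des \<sigma>))"
    and "(\<Sum>\<sigma>\<in>stirling_perms n. F (Asc \<sigma>) (Plat \<sigma>) (Des \<sigma>)) =
           (\<Sum>\<sigma>\<in>stirling_perms n. F (Des \<sigma>) (Plat \<sigma>) (Asc \<sigma>))"
proof (induction n arbitrary: F)
  case 0
  { case 1 show ?case by (simp add: stirling_perms_0 Asc_def Plat_def) }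
  { case 2 show ?case by (simp add: stirling_perms_0 Asc_def Des_def) }
next
  case (Suc n)
  have empty: "letter [] i = 0" if "i \<le> Suc 0" for i
    using that by (auto simp: letter_def le_Suc_eq)
  have base: "Asc (insert_twice 1 0 []) = {1}" "Plat (insert_twice 1 0 []) = {1}" "Des (insert_twice 1 0 []) = {1}"
    using Asc_insert_twice[of 0 "[]" 1] Plat_insert_twice[of 0 "[]" 1] Des_insert_twice[of 0 "[]" 1] empty
    by (auto simp: asc_gaps_def plat_gaps_def des_gaps_def)
  define m where "m = Suc n"
  let ?G = "\<lambda>F A P D. (\<Sum>v\<in>A. F (insert m (A - {v})) (insert m P) (insert m D)) +
    (\<Sum>v\<in>P. F (insert m A) (insert m (P - {v})) (insert m D)) +
    (\<Sum>v\<in>D. F (insert m A) (insert m P) (insert m (D - {v}))) :: 'b"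
  have step: "(\<Sum>\<sigma>\<in>stirling_perms (Suc n). F (Asc \<sigma>) (Plat \<sigma>) (Des \<sigma>)) =
      (\<Sum>\<sigma>\<in>stirling_perms n. ?G F (Asc \<sigma>) (Plat \<sigma>) (Des \<sigma>))"
    if "n \<ge> 1" for F :: "nat set \<Rightarrow> nat set \<Rightarrow> nat set \<Rightarrow> 'b"
    unfolding sum_stirling_perms_Suc m_def
    by (intro sum.cong refl sum_over_insertions that)
  { case 1
    show ?case
    proof (cases "n = 0")
      case True
      then show ?thesis using base by (simp add: sum_stirling_perms_Suc stirling_perms_0)
    next
      case False
      then show ?thesis
        using step[of F] step[of "\<lambda>A P D. F P A D"] Suc.IH(1)[of "?G F"] by (simp add: ac_simps)
    qed }
  { case 2
    show ?case
    proof (cases "n = 0")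
      case True
      then show ?thesis using base by (simp add: sum_stirling_perms_Suc stirling_perms_0)
    next
      case False
      then show ?thesis
        using step[of F] step[of "\<lambda>A P D. F D P A"] Suc.IH(2)[of "?G F"] by (simp add: ac_simps)
    qed }
qed

abbreviation (input) six_pairs :: "(set_stat \<times> set_stat) set" where
  "six_pairs \<equiv> {(Asc, Lap), (Plat, Lap), (Des, Rpd), (Asc, Eud), (Plat, Rpd), (Des, Eud)}"

text \<open>
  Each of the other five ordered pairs \<open>(X, Y)\<close> is reached from \<open>(Asc, Plat)\<close> by one or two
  transpositions, and \<open>f (X \<sigma>) (X \<sigma> \<inter> Y \<sigma>)\<close> is a function of the triple.
\<close>

lemma sum_six_pairs:
  fixes f :: "nat set \<Rightarrow> nat set \<Rightarrow> 'b :: comm_monoid_add"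
  assumes "(S, T) \<in> six_pairs"
  shows "(\<Sum>\<sigma>\<in>stirling_perms n. f (S \<sigma>) (T \<sigma>)) = (\<Sum>\<sigma>\<in>stirling_perms n. f (Asc \<sigma>) (Lap \<sigma>))"
proof -
  let ?S = "\<lambda>X Y. \<Sum>\<sigma>\<in>stirling_perms n. f (X \<sigma>) (X \<sigma> \<inter> Y \<sigma>)"
  note AP = Asc_Plat_Des_symmetric(1)[where n = n] and AD = Asc_Plat_Des_symmetric(2)[where n = n]
  have PA: "?S Plat Asc = ?S Asc Plat" using AP[of "\<lambda>A P D. f A (A \<inter> P)"] by simp
  have DP: "?S Des Plat = ?S Asc Plat" using AD[of "\<lambda>A P D. f A (A \<inter> P)"] by simp
  have PD: "?S Plat Des = ?S Asc Plat"
    using AD[of "\<lambda>A P D. f P (P \<inter> A)"] PA by simp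
  have AD': "?S Asc Des = ?S Asc Plat"
    using AP[of "\<lambda>A P D. f A (A \<inter> D)"] PD by simp
  have DA: "?S Des Asc = ?S Asc Plat"
    using AD[of "\<lambda>A P D. f A (A \<inter> D)"] AD' by simp
  have "(\<Sum>\<sigma>\<in>stirling_perms n. f (Asc \<sigma>) (Lap \<sigma>)) = ?S Asc Plat"
    by (simp add: Lap_eq)
  moreover have "(\<Sum>\<sigma>\<in>stirling_perms n. f (Plat \<sigma>) (Lap \<sigma>)) = ?S Plat Asc"
    by (simp add: Lap_eq Int_commute)
  moreover have "(\<Sum>\<sigma>\<in>stirling_perms n. f (Des \<sigma>) (Rpd \<sigma>)) = ?S Des Plat"
    by (simp add: Rpd_eq Int_commute)
  moreover have "(\<Sum>\<sigma>\<in>stirling_perms n. f (Asc \<sigma>) (Eud \<sigma>)) = ?S Asc Des"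
    by (simp add: Eud_eq)
  moreover have "(\<Sum>\<sigma>\<in>stirling_perms n. f (Plat \<sigma>) (Rpd \<sigma>)) = ?S Plat Des"
    by (simp add: Rpd_eq)
  moreover have "(\<Sum>\<sigma>\<in>stirling_perms n. f (Des \<sigma>) (Eud \<sigma>)) = ?S Des Asc"
    by (simp add: Eud_eq Int_commute)
  ultimately show ?thesis using assms PA DP PD AD' DA by auto
qed

lemma finite_stirling_perms: "finite (stirling_perms n)"
  by (simp add: stirling_perms_def)

lemma equidistributed_six_pairs:
  assumes "p \<in> six_pairs" "q \<in> six_pairs"
  shows "equidistributed n p q"
  unfolding equidistributed_def
proof (intro allI impI)
  fix A B :: "nat set"
  have "card {\<sigma> \<in> stirling_perms n. S \<sigma> = A \<and> T \<sigma> = B} =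
      card {\<sigma> \<in> stirling_perms n. Asc \<sigma> = A \<and> Lap \<sigma> = B}" if "(S, T) \<in> six_pairs" for S T
    using sum_six_pairs[OF that, of "\<lambda>X Y. if X = A \<and> Y = B then 1 else 0 :: nat" n]
    by (simp add: sum.If_cases finite_stirling_perms Int_def)
  from this[of "fst p" "snd p"] this[of "fst q" "snd q"] assms
  show "card {\<sigma> \<in> stirling_perms n. fst p \<sigma> = A \<and> snd p \<sigma> = B} =
      card {\<sigma> \<in> stirling_perms n. fst q \<sigma> = A \<and> snd q \<sigma> = B}" by simp
qed

theorem theorem14:
  fixes n :: nat and x y :: "'a :: comm_semiring_1"
  assumes "n \<ge> 1"
  shows "pairwise (equidistributed n)
      {(Asc, Lap), (Plat, Lap), (Des, Rpd), (Asc, Eud), (Plat, Rpd), (Des, Eud)}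
    \<and> (\<Sum>\<sigma>\<in>stirling_perms n. x ^ asc \<sigma> * y ^ lap \<sigma>)
           = (\<Sum>\<sigma>\<in>stirling_perms n. x ^ plat \<sigma> * y ^ lap \<sigma>)
       \<and> (\<Sum>\<sigma>\<in>stirling_perms n. x ^ plat \<sigma> * y ^ lap \<sigma>)
           = (\<Sum>\<sigma>\<in>stirling_perms n. x ^ des \<sigma> * y ^ rpd \<sigma>)
    \<and> (\<Sum>\<sigma>\<in>stirling_perms n. x ^ asc \<sigma> * y ^ lap \<sigma>)
           = (\<Sum>\<sigma>\<in>stirling_perms n. x ^ plat \<sigma> * y ^ rpd \<sigma>)
       \<and> (\<Sum>\<sigma>\<in>stirling_perms n. x ^ plat \<sigma> * y ^ rpd \<sigma>)
           = (\<Sum>\<sigma>\<in>stirling_perms n. x ^ des \<sigma> * y ^ rpd \<sigma>)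
    \<and> (\<Sum>\<sigma>\<in>stirling_perms n. x ^ asc \<sigma> * y ^ eud \<sigma>)
           = (\<Sum>\<sigma>\<in>stirling_perms n. x ^ plat \<sigma> * y ^ rpd \<sigma>)
       \<and> (\<Sum>\<sigma>\<in>stirling_perms n. x ^ plat \<sigma> * y ^ rpd \<sigma>)
           = (\<Sum>\<sigma>\<in>stirling_perms n. x ^ des \<sigma> * y ^ eud \<sigma>)
    \<and> (\<Sum>\<sigma>\<in>stirling_perms n. x ^ asc \<sigma> * y ^ eud \<sigma>)
           = (\<Sum>\<sigma>\<in>stirling_perms n. x ^ plat \<sigma> * y ^ lap \<sigma>)
       \<and> (\<Sum>\<sigma>\<in>stirling_perms n. x ^ plat \<sigma> * y ^ lap \<sigma>)
           = (\<Sum>\<sigma>\<in>stirling_perms n. x ^ des \<sigma> * y ^ eud \<sigma>)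
    \<and> (\<Sum>\<sigma>\<in>stirling_perms n. x ^ asc \<sigma> * y ^ lap \<sigma>)
           = (\<Sum>\<sigma>\<in>stirling_perms n. x ^ plat \<sigma> * y ^ rpd \<sigma>)
       \<and> (\<Sum>\<sigma>\<in>stirling_perms n. x ^ plat \<sigma> * y ^ rpd \<sigma>)
           = (\<Sum>\<sigma>\<in>stirling_perms n. x ^ des \<sigma> * y ^ eud \<sigma>)
    \<and> (\<Sum>\<sigma>\<in>stirling_perms n. x ^ asc \<sigma> * y ^ eud \<sigma>)
           = (\<Sum>\<sigma>\<in>stirling_perms n. x ^ plat \<sigma> * y ^ lap \<sigma>)
       \<and> (\<Sum>\<sigma>\<in>stirling_perms n. x ^ plat \<sigma> * y ^ lap \<sigma>)
           = (\<Sum>\<sigma>\<in>stirling_perms n. x ^ des \<sigma> * y ^ rpd \<sigma>)"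
proof -
  have "pairwise (equidistributed n) six_pairs"
    by (intro pairwiseI equidistributed_six_pairs)
  moreover have "(\<Sum>\<sigma>\<in>stirling_perms n. x ^ card (S \<sigma>) * y ^ card (T \<sigma>)) =
      (\<Sum>\<sigma>\<in>stirling_perms n. x ^ asc \<sigma> * y ^ lap \<sigma>)" if "(S, T) \<in> six_pairs" for S T
    using sum_six_pairs[OF that, of "\<lambda>X Y. x ^ card X * y ^ card Y" n] by (simp add: asc_def lap_def)
  note this[of Plat Lap] this[of Des Rpd] this[of Asc Eud] this[of Plat Rpd] this[of Des Eud]
  ultimately show ?thesis
    by (simp add: plat_def des_def rpd_def eud_def asc_def lap_def)
qed

end
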